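(* For every integer $k>0$, $$\zeta_{\mathcal P}(\{2\}^k)=\sum_{\ell(\lambda)=k}\frac{1}{n_\lambda^2}=\frac{2^{2k-1}-1}{2^{2k-2}}\,\zeta(2k).$$ For example, $$\zeta_{\mathcal P}(\{2\})=\zeta(2)=\frac{\pi^2}{6},\quad \zeta_{\mathcal P}(\{2\}^2)=\frac74\zeta(4)=\frac{7\pi^4}{360},\quad \zeta_{\mathcal P}(\{2\}^3)=\frac{31}{16}\zeta(6)=\frac{31\pi^6}{15120},$$ $$\zeta_{\mathcal P}(\{2\}^{13})=\frac{33554431}{16777216}\zeta(26)=\frac{22076500342261\,\pi^{26}}{93067260259985915904000000}.$$
   Context: A partition is a finite non-increasing sequence $\lambda=(\lambda_1,\dots,\lambda_r)$ of positive integers (including the empty partition, $r=0$); its length is $\ell(\lambda):=r$ and its integer is $n_\lambda:=\lambda_1\lambda_2\cdots\lambda_r$ (with $n_\emptyset:=1$). For $\operatorname{Re}(s)>1$ and an integer $k\ge0$, $\zeta_{\mathcal P}(\{s\}^k):=\sum_{\ell(\lambda)=k}n_\lambda^{-s}$, the sum being over all partitions of length exactly $k$; $\zeta_{\mathcal P}(\{s\})$ means $\zeta_{\mathcal P}(\{s\}^1)$. $\zeta$ is the Riemann zeta function. *)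

theory Defs
  imports "HOL-Analysis.Analysis"
begin

definition is_partition :: "nat list \<Rightarrow> bool" where
  "is_partition p \<longleftrightarrow> sorted_wrt (\<ge>) p \<and> (\<forall>a\<in>set p. 0 < a)"

definition partitions_of_length :: "nat \<Rightarrow> nat list set" where
  "partitions_of_length k = {p. is_partition p \<and> length p = k}"

(* The product of the parts, not their sum (the size of the partition). *)
definition partition_integer :: "nat list \<Rightarrow> nat" where
  "partition_integer p = prod_list p"

(* Meaningful for Re s > 1 only; an infsum that does not converge is 0. *)
definition zeta_P :: "complex \<Rightarrow> nat \<Rightarrow> complex" where
  "zeta_P s k = (\<Sum>\<^sub>\<infinity>p\<in>partitions_of_length k. of_nat (partition_integer p) powr (- s))"

(* The Riemann zeta function on the half-plane Re s > 1, where it is given by its Dirichlet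
   series; its analytic continuation is not covered. *)
definition zeta :: "complex \<Rightarrow> complex" where
  "zeta s = (\<Sum>n. 1 / of_nat (Suc n) powr s)"

end

(* Write x_n = 1/n^2. The sum over partitions of length k with parts at most N is the complete
   homogeneous symmetric polynomial h_k(x_1, ..., x_N), and partial fractions of its generating
   function give h_k = 2 * sum_{n <= N} (-1)^(n-1) c(N,n) / n^(2k) with
   c(N,n) = binomial(2N, N+n) / binomial(2N, N). The weights lie in [0,1] and tend to 1 as N grows,
   so by Tannery's theorem the limit is twice the alternating zeta value at 2k. For the explicit
   values, the generating function of the limits times sin(pi z) equals pi z (Euler's sine product),
   and comparing coefficients yields a recurrence. *)

theory Submission
  imports Defs "HOL-Complex_Analysis.Laurent_Convergence"
begin

section \<open>Partitions with bounded parts\<close>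

definition bounded_partitions :: "nat \<Rightarrow> nat \<Rightarrow> nat list set" where
  "bounded_partitions N k = {p \<in> partitions_of_length k. set p \<subseteq> {..N}}"

definition truncated_zeta_P :: "nat \<Rightarrow> nat \<Rightarrow> real" where
  "truncated_zeta_P N k = (\<Sum>p\<in>bounded_partitions N k. 1 / (real (partition_integer p))\<^sup>2)"

lemma finite_bounded_partitions: "finite (bounded_partitions N k)"
  by (rule finite_subset[OF _ finite_lists_length_eq[of "{..N}" k]])
     (auto simp: bounded_partitions_def partitions_of_length_def)

lemma bounded_partitions_0_right: "bounded_partitions N 0 = {[]}"
  by (auto simp: bounded_partitions_def partitions_of_length_def is_partition_def)

lemma bounded_partitions_0_left: "bounded_partitions 0 (Suc k) = {}"
  by (force simp: bounded_partitions_def partitions_of_length_def is_partition_def length_Suc_conv)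

text \<open>The head of a non-increasing list is its largest part: if it is at most
  \<open>N\<close>, so are all parts; if it is \<open>Suc N\<close>, it can be removed.\<close>

lemma bounded_partitions_Suc_Suc:
  "bounded_partitions (Suc N) (Suc k) =
     bounded_partitions N (Suc k) \<union> Cons (Suc N) ` bounded_partitions (Suc N) k"
proof (intro equalityI subsetI)
  fix p assume p: "p \<in> bounded_partitions (Suc N) (Suc k)"
  then obtain a q where pq: "p = a # q"
    by (auto simp: bounded_partitions_def partitions_of_length_def length_Suc_conv)
  show "p \<in> bounded_partitions N (Suc k) \<union> Cons (Suc N) ` bounded_partitions (Suc N) k"
  proof (cases "a = Suc N")
    case True
    then have "q \<in> bounded_partitions (Suc N) k"
      using p pq by (auto simp: bounded_partitions_def partitions_of_length_def is_partition_def)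
    then show ?thesis using True pq by blast
  next
    case False
    then have "a \<le> N" using p pq by (auto simp: bounded_partitions_def)
    moreover have "\<forall>x\<in>set q. x \<le> a"
      using p pq by (auto simp: bounded_partitions_def partitions_of_length_def is_partition_def)
    ultimately have "set p \<subseteq> {..N}" using pq by force
    then show ?thesis using p by (auto simp: bounded_partitions_def)
  qed
next
  fix p assume "p \<in> bounded_partitions N (Suc k) \<union> Cons (Suc N) ` bounded_partitions (Suc N) k"
  then show "p \<in> bounded_partitions (Suc N) (Suc k)"
    by (force simp: bounded_partitions_def partitions_of_length_def is_partition_def)
qed

lemma truncated_zeta_P_0_right [simp]: "truncated_zeta_P N 0 = 1"
  by (simp add: truncated_zeta_P_def bounded_partitions_0_right partition_integer_def)

lemma truncated_zeta_P_0_left [simp]: "truncated_zeta_P 0 (Suc k) = 0"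
  by (simp add: truncated_zeta_P_def bounded_partitions_0_left)

text \<open>The usual recurrence of complete homogeneous symmetric polynomials in the number of
  variables. It drives both the partial fraction formula and the generating function.\<close>

lemma truncated_zeta_P_Suc_Suc:
  "truncated_zeta_P (Suc N) (Suc k) =
     truncated_zeta_P N (Suc k) + truncated_zeta_P (Suc N) k / (real (Suc N))\<^sup>2"
proof -
  have "bounded_partitions N (Suc k) \<inter> Cons (Suc N) ` bounded_partitions (Suc N) k = {}"
    by (auto simp: bounded_partitions_def)
  then have "truncated_zeta_P (Suc N) (Suc k) = truncated_zeta_P N (Suc k) +
      (\<Sum>p\<in>Cons (Suc N) ` bounded_partitions (Suc N) k. 1 / (real (partition_integer p))\<^sup>2)"
    unfolding truncated_zeta_P_def bounded_partitions_Suc_Suc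
    by (intro sum.union_disjoint finite_imageI finite_bounded_partitions)
  also have "(\<Sum>p\<in>Cons (Suc N) ` bounded_partitions (Suc N) k.
        1 / (real (partition_integer p))\<^sup>2) =
      (\<Sum>p\<in>bounded_partitions (Suc N) k.
        1 / (real (partition_integer p))\<^sup>2 / (real (Suc N))\<^sup>2)"
    by (subst sum.reindex) (auto simp: partition_integer_def power_mult_distrib mult.commute simp del: of_nat_Suc mult_Suc mult_Suc_right)
  finally show ?thesis by (simp add: truncated_zeta_P_def sum_divide_distrib)
qed

text \<open>Convergence along the sets \<open>bounded_partitions N k\<close> suffices: they exhaust
  the partitions of length \<open>k\<close>, and since the terms are nonnegative, bounded partial
  sums give unconditional summability.\<close>

lemma partition_integer_has_sum:
  assumes "(\<lambda>N. truncated_zeta_P N k) \<longlonglongrightarrow> L"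
  shows "((\<lambda>p. 1 / (real (partition_integer p))\<^sup>2) has_sum L) (partitions_of_length k)"
proof -
  let ?f = "\<lambda>p. 1 / (real (partition_integer p))\<^sup>2"
  \<comment> \<open>If no list in \<open>X\<close> has an entry, \<open>Max\<close> is applied to
    the empty set and its value is unspecified; the inclusion then holds for any bound, as
    \<open>[]\<close> respects them all.\<close>
  have exhaust: "X \<subseteq> bounded_partitions (Max (\<Union> (set ` X))) k"
    if X: "finite X" "X \<subseteq> partitions_of_length k" for X
    using X by (auto simp: bounded_partitions_def intro!: Max_ge)
  have mono: "bounded_partitions M k \<subseteq> bounded_partitions N k" if "M \<le> N" for M N
    using that by (force simp: bounded_partitions_def)
  have lim: "filterlim (\<lambda>N. bounded_partitions N k) (finite_subsets_at_top (partitions_of_length k)) sequentially"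
    unfolding filterlim_finite_subsets_at_top
  proof (intro allI impI)
    fix X assume X: "finite X \<and> X \<subseteq> partitions_of_length k"
    show "\<forall>\<^sub>F N in sequentially. finite (bounded_partitions N k) \<and> X \<subseteq> bounded_partitions N k
        \<and> bounded_partitions N k \<subseteq> partitions_of_length k"
      using eventually_ge_at_top[of "Max (\<Union> (set ` X))"]
    proof eventually_elim
      case (elim N)
      then show ?case
        using exhaust[of X] mono[OF elim] X finite_bounded_partitions
        by (auto simp: bounded_partitions_def)
    qed
  qed
  from assms have "Bseq (\<lambda>N. truncated_zeta_P N k)"
    using convergent_imp_Bseq convergentI by blast
  then obtain C where C: "\<And>N. norm (truncated_zeta_P N k) \<le> C" unfolding Bseq_def by blast
  have "?f summable_on partitions_of_length k"
  proof (rule nonneg_bounded_partial_sums_imp_summable_on)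
    have "sum ?f X \<le> C" if X: "finite X" "X \<subseteq> partitions_of_length k" for X
    proof -
      have "sum ?f X \<le> truncated_zeta_P (Max (\<Union> (set ` X))) k"
        unfolding truncated_zeta_P_def
        by (intro sum_mono2 finite_bounded_partitions exhaust X) auto
      then show ?thesis using C[of "Max (\<Union> (set ` X))"] by auto
    qed
    then show "\<forall>\<^sub>F X in finite_subsets_at_top (partitions_of_length k). sum ?f X \<le> C"
      by (intro eventually_finite_subsets_at_top_weakI)
  qed auto
  then have sum: "(?f has_sum infsum ?f (partitions_of_length k)) (partitions_of_length k)"
    by (rule has_sum_infsum)
  then have "(\<lambda>N. truncated_zeta_P N k) \<longlonglongrightarrow> infsum ?f (partitions_of_length k)"
    unfolding has_sum_def truncated_zeta_P_def by (rule filterlim_compose[OF _ lim])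
  then show ?thesis using sum assms LIMSEQ_unique by blast
qed

section \<open>Central binomial ratios\<close>

text \<open>For 1 \<le> i \<le> N, the number 2 (-1)^(i-1) \<open>central_ratio N i\<close> is the
  partial fraction coefficient: the product of 1 / (1 - i^2/j^2) over all j \<le> N other than i.
  The binomial form also gives 0 for i > N.\<close>

definition central_ratio :: "nat \<Rightarrow> nat \<Rightarrow> real" where
  "central_ratio N i = real ((2 * N) choose (N + i)) / real ((2 * N) choose N)"

lemma central_ratio_nonneg: "0 \<le> central_ratio N i"
  by (simp add: central_ratio_def)

lemma central_ratio_le_1: "central_ratio N i \<le> 1"
  using binomial_maximum'[of N "N + i"] by (simp add: central_ratio_def divide_le_eq)

lemma central_ratio_eq_0: "N < i \<Longrightarrow> central_ratio N i = 0"
  by (simp add: central_ratio_def)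

lemma central_ratio_Suc_right:
  "central_ratio N (Suc i) = central_ratio N i * (real N - real i) / (real N + real i + 1)"
proof (cases "i \<le> N")
  case True
  \<comment> \<open>Both sides equal 2N times the binomial coefficient of 2N - 1 over N + i.\<close>
  have "Suc (N + i) * ((2 * N) choose Suc (N + i)) = (2 * N - (N + i)) * ((2 * N) choose (N + i))"
    using binomial_absorption[of "N + i" "2 * N"] binomial_absorb_comp[of "2 * N" "N + i"] by simp
  moreover have "2 * N - (N + i) = N - i" by simp
  ultimately have "real (Suc (N + i)) * real ((2 * N) choose Suc (N + i)) =
      real (N - i) * real ((2 * N) choose (N + i))"
    by (metis of_nat_mult)
  then have "real ((2 * N) choose (N + Suc i)) =
      real ((2 * N) choose (N + i)) * (real N - real i) / (real N + real i + 1)"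
    using True by (subst eq_divide_eq) (simp add: of_nat_diff mult_ac add_ac)
  then show ?thesis by (simp add: central_ratio_def)
qed (simp add: central_ratio_eq_0)

lemma central_ratio_tendsto_1: "(\<lambda>N. central_ratio N i) \<longlonglongrightarrow> 1"
proof (induction i)
  case (Suc i)
  \<comment> \<open>This is the quotient of consecutive ratios, written so that its limit 1 for
    fixed \<open>i\<close> is visible.\<close>
  have "(\<lambda>N. 1 - (2 * real i + 1) / real (N + Suc i)) \<longlonglongrightarrow> 1 - 0"
    by (intro tendsto_diff tendsto_const LIMSEQ_ignore_initial_segment[OF lim_const_over_n])
  also have "(\<lambda>N. 1 - (2 * real i + 1) / real (N + Suc i)) =
      (\<lambda>N. (real N - real i) / (real N + real i + 1))"
    by (intro ext) (simp add: field_simps)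
  finally have "(\<lambda>N. (real N - real i) / (real N + real i + 1)) \<longlonglongrightarrow> 1" by simp
  from tendsto_mult[OF Suc this] show ?case by (simp add: central_ratio_Suc_right)
qed (simp add: central_ratio_def del: binomial_Suc_Suc)

text \<open>In the product form of the weights, raising N by one adjoins the factor with j = N + 1.
  The proof goes by induction on \<open>i\<close>, through the quotients of consecutive
  ratios.\<close>

lemma central_ratio_Suc_left:
  "central_ratio (Suc N) i * (1 - (real i)\<^sup>2 / (real (Suc N))\<^sup>2) = central_ratio N i"
proof (induction i)
  case (Suc i)
  show ?case
  proof (cases "i \<le> N")
    case True
    \<comment> \<open>Both sides reduce to (N + 1 - i) (N - i) / (N + 1)^2.\<close>
    have eq: "(real (Suc N) - real i) / (real (Suc N) + real i + 1) * (1 - (real (Suc i))\<^sup>2 / (real (Suc N))\<^sup>2)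
        = (1 - (real i)\<^sup>2 / (real (Suc N))\<^sup>2) * ((real N - real i) / (real N + real i + 1))"
      by (simp add: divide_simps add_nonneg_eq_0_iff) (simp add: algebra_simps power2_eq_square)
    have "central_ratio (Suc N) (Suc i) * (1 - (real (Suc i))\<^sup>2 / (real (Suc N))\<^sup>2) =
        central_ratio (Suc N) i * ((real (Suc N) - real i) / (real (Suc N) + real i + 1) *
          (1 - (real (Suc i))\<^sup>2 / (real (Suc N))\<^sup>2))"
      unfolding central_ratio_Suc_right by (simp only: times_divide_eq_right mult.assoc times_divide_eq_left)
    also have "\<dots> = central_ratio N i * ((real N - real i) / (real N + real i + 1))"
      unfolding eq Suc[symmetric] by (simp only: mult.assoc)
    finally show ?thesis by (simp add: central_ratio_Suc_right)
  qed (auto simp: central_ratio_eq_0)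
qed (simp add: central_ratio_def del: binomial_Suc_Suc)

section \<open>Alternating binomial sums and partial fractions\<close>

lemma alternating_binomial_partial_sum:
  "(\<Sum>n<m. (-1) ^ n * real (Suc M choose (a + Suc n))) =
     real (M choose a) - (-1) ^ m * real (M choose (a + m))"
  \<comment> \<open>By Pascal's rule each term splits into two neighbours, and the alternating signs
    make the sum telescope.\<close>
  by (induction m) (auto simp: algebra_simps)

text \<open>The case k = 0 of the partial fraction formula, where h_0 = 1; it starts the induction
  there.\<close>

lemma alternating_sum_central_ratio:
  assumes "0 < N"
  shows "2 * (\<Sum>n<N. (-1) ^ n * central_ratio N (Suc n)) = 1"
proof -
  obtain m where N: "N = Suc m" using assms by (cases N) auto
  \<comment> \<open>The second boundary term of the telescoped sum vanishes because N + N exceeds 2m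
    + 1.\<close>
  have "(\<Sum>n<N. (-1) ^ n * real ((2 * N) choose (N + Suc n))) = real (Suc (2 * m) choose N)"
    using alternating_binomial_partial_sum[where m = N and M = "Suc (2 * m)" and a = N]
    by (simp add: N del: binomial_Suc_Suc)
  moreover have "(2 * N) choose N = 2 * (Suc (2 * m) choose N)"
    using binomial_symmetric[of m "Suc (2 * m)"] binomial_Suc_Suc[of "Suc (2 * m)" m]
    by (simp add: N del: binomial_Suc_Suc)
  moreover have "Suc (2 * m) choose N > 0" by (simp add: N del: binomial_Suc_Suc)
  ultimately show ?thesis
    by (simp add: central_ratio_def flip: sum_divide_distrib)
qed

text \<open>The partial fraction formula; it fails for \<open>N = k = 0\<close>, where the left side is 1.\<close>

lemma truncated_zeta_P_eq:
  assumes "0 < N \<or> 0 < k"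
  shows "truncated_zeta_P N k =
           2 * (\<Sum>n<N. (-1) ^ n * central_ratio N (Suc n) / real (Suc n) ^ (2 * k))"
  using assms
proof (induction k arbitrary: N)
  case 0
  then show ?case by (simp add: alternating_sum_central_ratio)
next
  case (Suc k)
  show ?case
  proof (induction N)
    case (Suc N)
    \<comment> \<open>Replacing c(N,n) by c(N+1,n) (1 - n^2/(N+1)^2) gives each summand the same
      recurrence as \<open>truncated_zeta_P\<close>.\<close>
    have step: "(-1) ^ n * central_ratio (Suc N) (Suc n) / real (Suc n) ^ (2 * Suc k) =
        (-1) ^ n * central_ratio N (Suc n) / real (Suc n) ^ (2 * Suc k) +
        (-1) ^ n * central_ratio (Suc N) (Suc n) / real (Suc n) ^ (2 * k) / (real (Suc N))\<^sup>2" for n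
      unfolding central_ratio_Suc_left[of N "Suc n", symmetric]
      by (simp add: field_simps power2_eq_square del: of_nat_Suc)
    have "2 * (\<Sum>n<Suc N. (-1) ^ n * central_ratio (Suc N) (Suc n) / real (Suc n) ^ (2 * Suc k)) =
        2 * (\<Sum>n<Suc N. (-1) ^ n * central_ratio N (Suc n) / real (Suc n) ^ (2 * Suc k)) +
        2 * (\<Sum>n<Suc N. (-1) ^ n * central_ratio (Suc N) (Suc n) / real (Suc n) ^ (2 * k)) /
          (real (Suc N))\<^sup>2"
      unfolding step sum.distrib sum_divide_distrib[symmetric] by (simp only: distrib_left times_divide_eq_right)
    also have "(\<Sum>n<Suc N. (-1) ^ n * central_ratio N (Suc n) / real (Suc n) ^ (2 * Suc k)) =
        (\<Sum>n<N. (-1) ^ n * central_ratio N (Suc n) / real (Suc n) ^ (2 * Suc k))"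
      by (simp add: central_ratio_eq_0)
    finally show ?case
      \<comment> \<open>The outer hypothesis is used at \<open>Suc N\<close>, which is positive, so
        the excluded case N = k = 0 does not arise.\<close>
      using Suc.IH \<open>\<And>N. 0 < N \<or> 0 < k \<Longrightarrow> _ N\<close>[of "Suc N"] by (simp add: truncated_zeta_P_Suc_Suc)
  qed simp
qed

section \<open>Letting the bound on the parts tend to infinity\<close>

lemma summable_inverse_Suc_power:
  assumes "2 \<le> m"
  shows "summable (\<lambda>n. 1 / real (Suc n) ^ m)"
  using inverse_power_summable[OF assms, where 'a = real]
  by (subst (asm) summable_Suc_iff[symmetric]) (simp add: inverse_eq_divide)

text \<open>For k > 0 this is twice the Dirichlet eta function at 2k. At k = 0 the alternating
  series diverges, and the limit of the truncated sums is h_0 = 1.\<close>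

definition limit_zeta_P :: "nat \<Rightarrow> real" where
  "limit_zeta_P k = (if k = 0 then 1 else 2 * (\<Sum>n. (-1) ^ n / real (Suc n) ^ (2 * k)))"

text \<open>A summable majorant independent of both \<open>N\<close> and \<open>k\<close>: the
  former serves Tannery's theorem, the latter bounds the coefficients of the generating
  functions.\<close>

lemma norm_central_ratio_term_le:
  assumes "0 < k"
  shows "norm ((-1) ^ n * central_ratio N (Suc n) / real (Suc n) ^ (2 * k)) \<le> 1 / (real (Suc n))\<^sup>2"
proof -
  have "norm ((-1) ^ n * central_ratio N (Suc n) / real (Suc n) ^ (2 * k)) =
      central_ratio N (Suc n) / real (Suc n) ^ (2 * k)"
    by (simp add: abs_mult power_abs central_ratio_nonneg)
  also have "\<dots> \<le> 1 / (real (Suc n))\<^sup>2"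
    using assms by (intro frac_le central_ratio_le_1 power_increasing) auto
  finally show ?thesis .
qed

lemma truncated_zeta_P_tendsto: "(\<lambda>N. truncated_zeta_P N k) \<longlonglongrightarrow> limit_zeta_P k"
proof (cases "k = 0")
  case False
  let ?a = "\<lambda>n N. (-1) ^ n * central_ratio N (Suc n) / real (Suc n) ^ (2 * k)"
  have "(\<lambda>N. suminf (\<lambda>n. ?a n N)) \<longlonglongrightarrow> (\<Sum>n. (-1) ^ n * 1 / real (Suc n) ^ (2 * k))"
  proof (rule tannerys_theorem[THEN conjunct2, THEN conjunct2])
    show "\<forall>\<^sub>F (n, N) in sequentially \<times>\<^sub>F sequentially. norm (?a n N) \<le> 1 / (real (Suc n))\<^sup>2"
      using norm_central_ratio_term_le False by (intro always_eventually) blast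
    show "summable (\<lambda>n. 1 / (real (Suc n))\<^sup>2)" by (rule summable_inverse_Suc_power) simp
    show "(\<lambda>N. ?a n N) \<longlonglongrightarrow> (-1) ^ n * 1 / real (Suc n) ^ (2 * k)" for n
      by (intro tendsto_divide tendsto_mult tendsto_const central_ratio_tendsto_1) simp
  qed simp
  \<comment> \<open>The weights vanish for n \<ge> N, so each finite sum is a full series, as
    Tannery's theorem requires.\<close>
  moreover have "suminf (\<lambda>n. ?a n N) = (\<Sum>n<N. ?a n N)" for N
    by (rule suminf_finite) (auto simp: central_ratio_eq_0)
  ultimately have "(\<lambda>N. 2 * (\<Sum>n<N. ?a n N)) \<longlonglongrightarrow> limit_zeta_P k"
    using False by (auto simp: limit_zeta_P_def intro!: tendsto_intros)
  then show ?thesis using False by (subst truncated_zeta_P_eq) auto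
qed (simp add: limit_zeta_P_def)

text \<open>Uniformity in \<open>k\<close> makes the generating function converge on the unit disc,
  and uniformity in \<open>N\<close> allows the limit inside it. The summand 1 covers k = 0.\<close>

lemma norm_truncated_zeta_P_le:
  "norm (truncated_zeta_P N k) \<le> 1 + 2 * (\<Sum>n. 1 / (real (Suc n))\<^sup>2)"
proof (cases "k = 0")
  case False
  have "norm (\<Sum>n<N. (-1) ^ n * central_ratio N (Suc n) / real (Suc n) ^ (2 * k))
      \<le> (\<Sum>n<N. 1 / (real (Suc n))\<^sup>2)"
    using False by (intro sum_norm_le norm_central_ratio_term_le) auto
  also have "\<dots> \<le> (\<Sum>n. 1 / (real (Suc n))\<^sup>2)"
    by (rule sum_le_suminf) (auto intro: summable_inverse_Suc_power simp del: of_nat_Suc)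
  finally show ?thesis using False by (simp add: truncated_zeta_P_eq abs_mult)
qed (use suminf_nonneg[OF summable_inverse_Suc_power[of 2]] in simp)

lemma norm_limit_zeta_P_le: "norm (limit_zeta_P k) \<le> 1 + 2 * (\<Sum>n. 1 / (real (Suc n))\<^sup>2)"
  by (rule Lim_norm_ubound[OF _ truncated_zeta_P_tendsto])
     (use norm_truncated_zeta_P_le in auto)

text \<open>The relation eta(m) = (1 - 2^(1-m)) zeta(m): subtracting twice the terms with even
  denominators makes the series alternate.\<close>

lemma limit_zeta_P_eq_zeta:
  assumes "0 < k"
  shows "of_real (limit_zeta_P k) = (2 ^ (2 * k - 1) - 1) / 2 ^ (2 * k - 2) * zeta (of_nat (2 * k))"
proof -
  define m where "m = 2 * k"
  have m: "2 \<le> m" using assms by (simp add: m_def)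
  define Z where "Z = (\<Sum>n. 1 / real (Suc n) ^ m)"
  have Z: "(\<lambda>n. 1 / real (Suc n) ^ m) sums Z"
    unfolding Z_def by (rule summable_sums summable_inverse_Suc_power m)+
  \<comment> \<open>Since the series starts at \<open>Suc n\<close>, odd indices belong to even
    denominators. The factor 1 - (-1)^n is 2 there and 0 elsewhere.\<close>
  have "(\<lambda>n. (1 - (-1) ^ (2 * n + 1)) / real (Suc (2 * n + 1)) ^ m) sums (2 / 2 ^ m * Z)"
  proof -
    have "real (Suc (2 * n + 1)) = 2 * real (Suc n)" for n by simp
    then have "(\<lambda>n. (1 - (-1) ^ (2 * n + 1)) / real (Suc (2 * n + 1)) ^ m) =
        (\<lambda>n. 2 / 2 ^ m * (1 / real (Suc n) ^ m))"
      by (simp only: power_mult_distrib) simp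
    then show ?thesis using sums_mult[OF Z, of "2 / 2 ^ m"] by simp
  qed
  moreover have "strict_mono (\<lambda>n::nat. 2 * n + 1)" by (simp add: strict_mono_def)
  moreover have "(1 - (-1) ^ n) / real (Suc n) ^ m = 0" if "n \<notin> range (\<lambda>n. 2 * n + 1)" for n
    using that by (cases "even n") (auto elim!: oddE)
  ultimately have "(\<lambda>n. (1 - (-1) ^ n) / real (Suc n) ^ m) sums (2 / 2 ^ m * Z)"
    using sums_mono_reindex[of "\<lambda>n. 2 * n + 1" "\<lambda>n. (1 - (-1) ^ n) / real (Suc n) ^ m" "2 / 2 ^ m * Z"]
    by blast
  from sums_diff[OF Z this]
  have "(\<lambda>n. (-1) ^ n / real (Suc n) ^ m) sums (Z - 2 / 2 ^ m * Z)"
    by (simp add: diff_divide_distrib)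
  then have "limit_zeta_P k = 2 * (Z - 2 / 2 ^ m * Z)"
    using assms by (simp add: limit_zeta_P_def m_def sums_iff)
  also have "\<dots> = (2 ^ (m - 1) - 1) / 2 ^ (m - 2) * Z"
    using m by (auto simp: le_iff_add field_simps power_add)
  finally have "of_real (limit_zeta_P k) =
      (2 ^ (2 * k - 1) - 1) / 2 ^ (2 * k - 2) * (of_real Z :: complex)"
    by (simp add: m_def)
  moreover have "(\<lambda>n. of_real (1 / real (Suc n) ^ m)) sums (of_real Z :: complex)"
    using Z by (rule sums_of_real)
  then have "(\<lambda>n. 1 / of_nat (Suc n) powr of_nat m) sums (of_real Z :: complex)"
    using m by (simp add: powr_nat' del: of_nat_Suc)
  then have "zeta (of_nat (2 * k)) = of_real Z"
    unfolding zeta_def m_def by (rule sums_unique[symmetric])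
  ultimately show ?thesis by simp
qed

section \<open>The generating function\<close>

lemma summable_truncated_zeta_P_power:
  fixes x :: complex
  assumes "norm x < 1"
  shows "summable (\<lambda>k. of_real (truncated_zeta_P N k) * x ^ k)"
proof (rule summable_comparison_test)
  let ?C = "1 + 2 * (\<Sum>n. 1 / (real (Suc n))\<^sup>2)"
  show "\<exists>M. \<forall>k\<ge>M. norm (of_real (truncated_zeta_P N k) * x ^ k) \<le> ?C * norm x ^ k"
    using norm_truncated_zeta_P_le[of N]
    by (auto simp: norm_mult norm_power intro!: mult_right_mono)
  show "summable (\<lambda>k. ?C * norm x ^ k)"
    using assms by (intro summable_mult summable_geometric) simp
qed

text \<open>The recurrence says that going from N to N + 1 divides the series by 1 - x/(N+1)^2, so
  the series is the reciprocal of the product.\<close>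

lemma truncated_generating_function:
  fixes x :: complex
  assumes "norm x < 1"
  shows "(\<Sum>k. of_real (truncated_zeta_P N k) * x ^ k) * (\<Prod>j=1..N. 1 - x / (of_nat j)\<^sup>2) = 1"
proof (induction N)
  case 0
  have "(\<Sum>k. of_real (truncated_zeta_P 0 k) * x ^ k) = (\<Sum>k\<in>{0}. of_real (truncated_zeta_P 0 k) * x ^ k)"
    by (rule suminf_finite) (auto simp: gr0_conv_Suc)
  then show ?case by simp
next
  case (Suc N)
  let ?S = "\<lambda>N. \<Sum>k. of_real (truncated_zeta_P N k) * x ^ k"
  note summable = summable_truncated_zeta_P_power[OF assms]
  have "?S (Suc N) = 1 + (\<Sum>k. of_real (truncated_zeta_P (Suc N) (Suc k)) * x ^ Suc k)"
    using suminf_split_head[OF summable[of "Suc N"]] by simp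
  also have "(\<Sum>k. of_real (truncated_zeta_P (Suc N) (Suc k)) * x ^ Suc k) =
      (\<Sum>k. of_real (truncated_zeta_P N (Suc k)) * x ^ Suc k +
            x / (of_nat (Suc N))\<^sup>2 * (of_real (truncated_zeta_P (Suc N) k) * x ^ k))"
    by (simp add: truncated_zeta_P_Suc_Suc ring_distribs mult_ac del: of_nat_Suc)
  also have "\<dots> = (\<Sum>k. of_real (truncated_zeta_P N (Suc k)) * x ^ Suc k) +
      x / (of_nat (Suc N))\<^sup>2 * ?S (Suc N)"
    unfolding suminf_mult[OF summable, symmetric]
    using summable[of N] by (intro suminf_add[symmetric] summable_mult summable)
      (subst summable_Suc_iff)
  also have "1 + \<dots> = ?S N + x / (of_nat (Suc N))\<^sup>2 * ?S (Suc N)"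
    using suminf_split_head[OF summable[of N]] by simp
  finally have "?S (Suc N) * (1 - x / (of_nat (Suc N))\<^sup>2) = ?S N"
    by (simp add: algebra_simps)
  moreover have "(\<Prod>j=1..Suc N. 1 - x / (of_nat j)\<^sup>2) =
      (1 - x / (of_nat (Suc N))\<^sup>2) * (\<Prod>j=1..N. 1 - x / (of_nat j)\<^sup>2)"
    by (simp add: prod.nat_ivl_Suc')
  ultimately show ?case using Suc by (simp only: mult.assoc[symmetric])
qed

lemma generating_function:
  fixes z :: complex
  assumes "norm z < 1"
  shows "(\<Sum>k. of_real (limit_zeta_P k) * z ^ (2 * k)) * sin (of_real pi * z) = of_real pi * z"
proof -
  let ?C = "1 + 2 * (\<Sum>n. 1 / (real (Suc n))\<^sup>2)"
  have norm: "norm (z\<^sup>2) < 1" using assms by (simp add: norm_power power_less_one_iff)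
  have "(\<lambda>N. \<Sum>k. of_real (truncated_zeta_P N k) * (z\<^sup>2) ^ k)
      \<longlonglongrightarrow> (\<Sum>k. of_real (limit_zeta_P k) * (z\<^sup>2) ^ k)"
  proof (rule tannerys_theorem[THEN conjunct2, THEN conjunct2])
    show "\<forall>\<^sub>F (k, N) in sequentially \<times>\<^sub>F sequentially.
        norm (of_real (truncated_zeta_P N k) * (z\<^sup>2) ^ k) \<le> ?C * norm (z\<^sup>2) ^ k"
      using norm_truncated_zeta_P_le
      by (intro always_eventually) (auto simp: norm_mult norm_power intro!: mult_right_mono)
    show "summable (\<lambda>k. ?C * norm (z\<^sup>2) ^ k)"
      using norm by (intro summable_mult summable_geometric) simp
  qed (auto intro!: tendsto_intros truncated_zeta_P_tendsto)
  \<comment> \<open>By the truncated identity this sequence is constantly pi z, which therefore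
    equals its limit.\<close>
  from tendsto_mult[OF this sin_product_formula_complex[of z]]
  have "(\<lambda>N. of_real pi * z * ((\<Sum>k. of_real (truncated_zeta_P N k) * (z\<^sup>2) ^ k) *
        (\<Prod>j=1..N. 1 - z\<^sup>2 / (of_nat j)\<^sup>2)))
      \<longlonglongrightarrow> (\<Sum>k. of_real (limit_zeta_P k) * (z\<^sup>2) ^ k) * sin (of_real pi * z)"
    by (simp only: mult_ac)
  then show ?thesis
    unfolding truncated_generating_function[OF norm] power_mult
    by (simp add: LIMSEQ_const_iff)
qed

text \<open>This is the coefficient of z^(2k+1) in the generating function times sin(pi z), which is
  0 for k > 0. Dividing by pi^(2k+1) leaves a recurrence with rational coefficients for
  \<open>limit_zeta_P j / pi ^ (2 * j)\<close>.\<close>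

lemma limit_zeta_P_recurrence:
  assumes "0 < k"
  shows "(\<Sum>j\<le>k. (-1) ^ (k - j) * limit_zeta_P j / pi ^ (2 * j) / fact (2 * (k - j) + 1)) = 0"
proof -
  let ?C = "1 + 2 * (\<Sum>n. 1 / (real (Suc n))\<^sup>2)"
  define G :: "complex fps" where
    "G = Abs_fps (\<lambda>n. if even n then of_real (limit_zeta_P (n div 2)) else 0)"
  have G: "fps_nth G (2 * n) = of_real (limit_zeta_P n)" "fps_nth G (Suc (2 * n)) = 0" for n
    by (simp_all add: G_def)
  \<comment> \<open>Bounded coefficients give a positive radius of convergence, which is enough to
    compare expansions at 0.\<close>
  have "norm (fps_nth G n) \<le> ?C" for n
    using norm_limit_zeta_P_le[of "n div 2"] by (auto simp: G_def)
  then have "summable (\<lambda>n. fps_nth G n * (1 / 2) ^ n)"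
    by (intro summable_comparison_test[OF _ summable_mult[OF summable_geometric[of "1 / 2"], of ?C]])
       (auto simp: norm_mult norm_power intro!: mult_right_mono)
  from conv_radius_geI[OF this] have "ereal (1 / 2) \<le> fps_conv_radius G"
    by (simp only: fps_conv_radius_def) simp
  then have radius: "fps_conv_radius G > 0" by (rule less_le_trans[rotated]) simp
  have eval: "eval_fps G z * sin (of_real pi * z) = of_real pi * z"
    if z: "norm z < 1" "ereal (norm z) < fps_conv_radius G" for z
  proof -
    have "(\<lambda>n. fps_nth G n * z ^ n) sums eval_fps G z"
      using z by (intro sums_eval_fps)
    then have "(\<lambda>k. fps_nth G (2 * k) * z ^ (2 * k)) sums eval_fps G z"
      by (subst sums_mono_reindex[where g = "\<lambda>k. 2 * k" and f = "\<lambda>n. fps_nth G n * z ^ n"])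
         (auto simp: strict_mono_def G_def elim!: evenE)
    then have "eval_fps G z = (\<Sum>k. of_real (limit_zeta_P k) * z ^ (2 * k))"
      by (simp add: G sums_iff)
    then show ?thesis using generating_function[OF z(1)] by simp
  qed
  have "(\<lambda>z. eval_fps G z * sin (of_real pi * z)) has_fps_expansion G * fps_sin (of_real pi)"
    using radius by (intro has_fps_expansion_mult has_fps_expansion_sin) (auto simp: has_fps_expansion_def)
  moreover have "\<forall>\<^sub>F z in nhds 0. eval_fps G z * sin (of_real pi * z) = of_real pi * z"
  proof -
    have "\<forall>\<^sub>F z in nhds 0. z \<in> eball (0::complex) (fps_conv_radius G) \<inter> ball 0 1"
      using radius by (intro eventually_nhds_in_open) (auto simp: zero_ereal_def)
    then show ?thesis by eventually_elim (auto intro: eval)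
  qed
  ultimately have "(\<lambda>z. of_real pi * z) has_fps_expansion G * fps_sin (of_real pi)"
    by (subst (asm) has_fps_expansion_cong) auto
  moreover have "(\<lambda>z. of_real pi * z) has_fps_expansion fps_const (of_real pi :: complex) * fps_X"
    by (intro fps_expansion_intros)
  ultimately have "G * fps_sin (of_real pi) = fps_const (of_real pi) * fps_X"
    by (rule fps_expansion_unique_complex)
  then have "fps_nth (G * fps_sin (of_real pi)) (2 * k + 1) = 0"
    using assms by simp
  also have "fps_nth (G * fps_sin (of_real pi)) (2 * k + 1) =
      (\<Sum>i\<in>(\<lambda>j. 2 * j) ` {..k}. fps_nth G i * fps_nth (fps_sin (of_real pi)) (2 * k + 1 - i))"
    unfolding fps_mult_nth by (rule sum.mono_neutral_right) (auto simp: G_def elim!: evenE)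
  also have "\<dots> = (\<Sum>j\<le>k. of_real (limit_zeta_P j) *
      fps_nth (fps_sin (of_real pi)) (2 * (k - j) + 1))"
    by (subst sum.reindex) (auto simp: inj_on_def G Suc_diff_le diff_mult_distrib2 intro!: sum.cong)
  also have "\<dots> = of_real (\<Sum>j\<le>k. (-1) ^ (k - j) * limit_zeta_P j * pi ^ (2 * (k - j) + 1) /
      fact (2 * (k - j) + 1))"
    by (simp add: fps_sin_def mult_ac del: fact_Suc)
  finally have "(\<Sum>j\<le>k. (-1) ^ (k - j) * limit_zeta_P j * pi ^ (2 * (k - j) + 1) /
      fact (2 * (k - j) + 1)) = 0"
    by (simp only: of_real_eq_0_iff)
  also have "(\<Sum>j\<le>k. (-1) ^ (k - j) * limit_zeta_P j * pi ^ (2 * (k - j) + 1) /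
      fact (2 * (k - j) + 1)) = pi ^ (2 * k + 1) *
      (\<Sum>j\<le>k. (-1) ^ (k - j) * limit_zeta_P j / pi ^ (2 * j) / fact (2 * (k - j) + 1))"
    unfolding sum_distrib_left
  proof (intro sum.cong refl)
    fix j assume "j \<in> {..k}"
    then have "2 * k + 1 = 2 * (k - j) + 1 + 2 * j" by simp
    then have "pi ^ (2 * k + 1) = pi ^ (2 * (k - j) + 1) * pi ^ (2 * j)" by (metis power_add)
    then show "(-1) ^ (k - j) * limit_zeta_P j * pi ^ (2 * (k - j) + 1) / fact (2 * (k - j) + 1) =
        pi ^ (2 * k + 1) * ((-1) ^ (k - j) * limit_zeta_P j / pi ^ (2 * j) / fact (2 * (k - j) + 1))"
      by (simp only:) simp
  qed
  finally show ?thesis by simp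
qed

lemma limit_zeta_P_values:
  shows "limit_zeta_P 1 = pi\<^sup>2 / 6"
    and "limit_zeta_P 2 = 7 * pi ^ 4 / 360"
    and "limit_zeta_P 3 = 31 * pi ^ 6 / 15120"
    and "limit_zeta_P 13 = 22076500342261 * pi ^ 26 / 93067260259985915904000000"
proof -
  \<comment> \<open>These are the Taylor coefficients of x / sin x at x^(2j), hence
    rational.\<close>
  define q where "q j = limit_zeta_P j / pi ^ (2 * j)" for j
  have q: "limit_zeta_P j = q j * pi ^ (2 * j)" for j by (simp add: q_def)
  \<comment> \<open>The term j = k has coefficient 1, so the recurrence can be solved for
    \<open>q k\<close>.\<close>
  have rec: "q k = - (\<Sum>j<k. (-1) ^ (k - j) * q j / fact (2 * (k - j) + 1))" if "0 < k" for k
  proof -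
    have "(\<Sum>j\<le>k. (-1) ^ (k - j) * q j / fact (2 * (k - j) + 1)) = 0"
      using limit_zeta_P_recurrence[OF that] by (simp add: q_def)
    then show ?thesis by (simp add: lessThan_Suc_atMost[symmetric])
  qed
  have q0: "q 0 = 1" by (simp add: q_def limit_zeta_P_def)
  have q1: "q (Suc 0) = 1 / 6"
    using rec[of 1] by (simp add: lessThan_nat_numeral lessThan_Suc fact_numeral q0)
  have q2: "q 2 = 7 / 360"
    using rec[of 2] by (simp add: lessThan_nat_numeral lessThan_Suc fact_numeral q0 q1)
  have q3: "q 3 = 31 / 15120"
    using rec[of 3] by (simp add: lessThan_nat_numeral lessThan_Suc fact_numeral q0 q1 q2)
  have q4: "q 4 = 127 / 604800"
    using rec[of 4] by (simp add: lessThan_nat_numeral lessThan_Suc fact_numeral q0 q1 q2 q3)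
  have q5: "q 5 = 73 / 3421440"
    using rec[of 5] by (simp add: lessThan_nat_numeral lessThan_Suc fact_numeral q0 q1 q2 q3 q4)
  have q6: "q 6 = 1414477 / 653837184000"
    using rec[of 6] by (simp add: lessThan_nat_numeral lessThan_Suc fact_numeral q0 q1 q2 q3 q4 q5)
  have q7: "q 7 = 8191 / 37362124800"
    using rec[of 7] by (simp add: lessThan_nat_numeral lessThan_Suc fact_numeral q0 q1 q2 q3 q4 q5 q6)
  have q8: "q 8 = 16931177 / 762187345920000"
    using rec[of 8] by (simp add: lessThan_nat_numeral lessThan_Suc fact_numeral q0 q1 q2 q3 q4 q5 q6 q7)
  have q9: "q 9 = 5749691557 / 2554547108585472000"
    using rec[of 9] by (simp add: lessThan_nat_numeral lessThan_Suc fact_numeral q0 q1 q2 q3 q4 q5 q6 q7 q8)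
  have q10: "q 10 = 91546277357 / 401428831349145600000"
    using rec[of 10] by (simp add: lessThan_nat_numeral lessThan_Suc fact_numeral q0 q1 q2 q3 q4 q5 q6 q7 q8 q9)
  have q11: "q 11 = 3324754717 / 143888775912161280000"
    using rec[of 11] by (simp add: lessThan_nat_numeral lessThan_Suc fact_numeral q0 q1 q2 q3 q4 q5 q6 q7 q8 q9 q10)
  have q12: "q 12 = 1982765468311237 / 846912068365871834726400000"
    using rec[of 12] by (simp add: lessThan_nat_numeral lessThan_Suc fact_numeral q0 q1 q2 q3 q4 q5 q6 q7 q8 q9 q10 q11)
  have q13: "q 13 = 22076500342261 / 93067260259985915904000000"
    using rec[of 13] by (simp add: lessThan_nat_numeral lessThan_Suc fact_numeral q0 q1 q2 q3 q4 q5 q6 q7 q8 q9 q10 q11 q12)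
  show "limit_zeta_P 1 = pi\<^sup>2 / 6" using q[of 1] q1 by simp
  show "limit_zeta_P 2 = 7 * pi ^ 4 / 360" using q[of 2] q2 by simp
  show "limit_zeta_P 3 = 31 * pi ^ 6 / 15120" using q[of 3] q3 by simp
  show "limit_zeta_P 13 = 22076500342261 * pi ^ 26 / 93067260259985915904000000"
    using q[of 13] q13 by simp
qed

section \<open>Transfer to the complex sum over partitions\<close>

lemma zeta_P_2_term:
  "of_nat (partition_integer p) powr (- 2) = (1 / (of_nat (partition_integer p))\<^sup>2 :: complex)"
  \<comment> \<open>The identity holds for every list \<open>p\<close>, with both sides 0 if some
    part is 0, so it can rewrite under the infinite sum.\<close>
  using powr_nat'[of "of_nat (partition_integer p)" 2] by (simp add: powr_minus inverse_eq_divide)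

theorem corollary2p4:
  shows "(\<forall>k::nat. k > 0 \<longrightarrow>
            (\<lambda>p. 1 / (of_nat (partition_integer p))\<^sup>2 :: complex) summable_on partitions_of_length k
          \<and> zeta_P 2 k = (\<Sum>\<^sub>\<infinity>p\<in>partitions_of_length k. 1 / (of_nat (partition_integer p))\<^sup>2)
          \<and> (\<Sum>\<^sub>\<infinity>p\<in>partitions_of_length k. 1 / (of_nat (partition_integer p))\<^sup>2)
              = (2 ^ (2 * k - 1) - 1) / 2 ^ (2 * k - 2) * zeta (of_nat (2 * k)))
       \<and> zeta_P 2 1 = zeta 2 \<and> zeta 2 = of_real (pi\<^sup>2 / 6)
       \<and> zeta_P 2 2 = 7 / 4 * zeta 4 \<and> 7 / 4 * zeta 4 = of_real (7 * pi ^ 4 / 360)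
       \<and> zeta_P 2 3 = 31 / 16 * zeta 6 \<and> 31 / 16 * zeta 6 = of_real (31 * pi ^ 6 / 15120)
       \<and> zeta_P 2 13 = 33554431 / 16777216 * zeta 26
       \<and> 33554431 / 16777216 * zeta 26
           = of_real (22076500342261 * pi ^ 26 / 93067260259985915904000000)"
proof -
  let ?f = "\<lambda>p. 1 / (of_nat (partition_integer p))\<^sup>2 :: complex"
  \<comment> \<open>The sum is evaluated over the reals, where the terms are nonnegative, and then
    embedded into the complex numbers.\<close>
  have has_sum: "(?f has_sum of_real (limit_zeta_P k)) (partitions_of_length k)" for k
    using has_sum_of_real[OF partition_integer_has_sum[OF truncated_zeta_P_tendsto[of k]],
        where 'a = complex] by simp
  have infsum: "infsum ?f (partitions_of_length k) = of_real (limit_zeta_P k)" for k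
    using has_sum by (rule infsumI)
  have zeta_P: "zeta_P 2 k = infsum ?f (partitions_of_length k)" for k
    unfolding zeta_P_def zeta_P_2_term ..
  have zeta_eq: "zeta 2 = of_real (limit_zeta_P 1)" "7 / 4 * zeta 4 = of_real (limit_zeta_P 2)"
    "31 / 16 * zeta 6 = of_real (limit_zeta_P 3)"
    "33554431 / 16777216 * zeta 26 = of_real (limit_zeta_P 13)"
    using limit_zeta_P_eq_zeta[of 1] limit_zeta_P_eq_zeta[of 2]
      limit_zeta_P_eq_zeta[of 3] limit_zeta_P_eq_zeta[of 13] by simp_all
  show ?thesis
  proof (intro conjI allI impI)
    fix k :: nat assume "k > 0"
    then show "infsum ?f (partitions_of_length k) =
        (2 ^ (2 * k - 1) - 1) / 2 ^ (2 * k - 2) * zeta (of_nat (2 * k))"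
      unfolding infsum by (rule limit_zeta_P_eq_zeta)
    show "?f summable_on partitions_of_length k"
      using has_sum by (rule has_sum_imp_summable)
  qed (simp_all only: zeta_P infsum zeta_eq limit_zeta_P_values)
qed

end
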